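(* Let $r$ be a positive integer. For every integer $c$ with \[\binom{r}{2}-\left\lfloor\frac{r-2}{2}\right\rfloor\leq c\leq \binom{r}{2}-1,\] there does not exist an $(r,c)$-triangle-regular graph.
   Context: All graphs are simple and undirected. For integers $r,c\ge 0$, a graph is $(r,c)$-triangle-regular if every vertex has degree exactly $r$ and, for every vertex $v$, the open neighborhood $N(v)$ of $v$ induces exactly $c$ edges (equivalently, every vertex has degree $r$ and lies in exactly $c$ triangles). *)

theory Defs
  imports Complex_Main
begin

(* The vertex set may be finite or infinite.  It must be nonempty: the graph without vertices
   would vacuously be (r,c)-triangle-regular for all r and c. *)
definition simple_graph :: "'a set \<Rightarrow> 'a set set \<Rightarrow> bool" where
  "simple_graph V E \<longleftrightarrow> V \<noteq> {} \<and> (\<forall>e\<in>E. e \<subseteq> V \<and> card e = 2)"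

definition neighborhood :: "'a set set \<Rightarrow> 'a \<Rightarrow> 'a set" where
  "neighborhood E v = {u. {u, v} \<in> E}"

definition induced_edges :: "'a set set \<Rightarrow> 'a set \<Rightarrow> 'a set set" where
  "induced_edges E S = {e \<in> E. e \<subseteq> S}"

(* Finiteness of the neighborhood is explicit because card is 0 on infinite sets. *)
definition triangle_regular :: "nat \<Rightarrow> nat \<Rightarrow> 'a set \<Rightarrow> 'a set set \<Rightarrow> bool" where
  "triangle_regular r c V E \<longleftrightarrow>
     simple_graph V E \<and>
     (\<forall>v\<in>V. finite (neighborhood E v) \<and> card (neighborhood E v) = r \<and>
             card (induced_edges E (neighborhood E v)) = c)"

end

theory Submission
  imports Defs
begin

text \<open>
  Put \<open>k = (r choose 2) - c\<close>, so that every closed neighborhood \<open>N[v]\<close> contains exactly \<open>k\<close> pairs of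
  distinct nonadjacent vertices. As \<open>k \<ge> 1\<close>, there are adjacent \<open>v\<close>, \<open>x\<close> with \<open>N[v] \<noteq> N[x]\<close>. Let
  \<open>C = N[v] \<inter> N[x]\<close>, \<open>Y = N[v] - N[x]\<close>, \<open>Z = N[x] - N[v]\<close> and \<open>d = |Y| = |Z| \<ge> 1\<close>, so
  \<open>|C| = r + 1 - d \<ge> 1\<close>. The union \<open>C \<union> Y \<union> Z\<close> has \<open>r + 1 + d\<close> elements while \<open>|N[w]| = r + 1\<close>, so every
  \<open>w \<in> C\<close> has at least \<open>d\<close> non-neighbors in this union. Summing over \<open>w \<in> C\<close>, and counting each pair
  inside \<open>C\<close> once for \<open>N[v]\<close> and once for \<open>N[x]\<close>, gives \<open>2 k \<ge> d (r + 1 - d) \<ge> r\<close>.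
\<close>

definition closed_nbhd :: "'a set set \<Rightarrow> 'a \<Rightarrow> 'a set" where
  "closed_nbhd E v = insert v (neighborhood E v)"

text \<open>Pairs are ordered, so \<open>nonadj_pairs E S S\<close> is twice the number of
  nonadjacent pairs inside \<open>S\<close>; the diagonal adds nothing because \<open>p\<close> lies
  in its own closed neighborhood.\<close>

definition nonadj_pairs :: "'a set set \<Rightarrow> 'a set \<Rightarrow> 'a set \<Rightarrow> nat" where
  "nonadj_pairs E S T = (\<Sum>p\<in>S. \<Sum>q\<in>T. of_bool (q \<notin> closed_nbhd E p))"

lemma closed_nbhd_sym: "q \<in> closed_nbhd E p \<longleftrightarrow> p \<in> closed_nbhd E q"
  by (auto simp: closed_nbhd_def neighborhood_def insert_commute)

lemma nonadj_pairs_commute: "nonadj_pairs E S T = nonadj_pairs E T S"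
  unfolding nonadj_pairs_def by (subst sum.swap) (simp add: closed_nbhd_sym)

lemma nonadj_pairs_Un_right:
  assumes "finite T" "finite U" "T \<inter> U = {}"
  shows "nonadj_pairs E S (T \<union> U) = nonadj_pairs E S T + nonadj_pairs E S U"
  using assms by (simp add: nonadj_pairs_def sum.union_disjoint sum.distrib del: sum_of_bool_eq)

text \<open>Mixed pairs occur in both orders, hence the factor 2; the inequality drops the pairs
  inside \<open>T\<close>.\<close>

lemma nonadj_pairs_Un_self_ge:
  assumes "finite S" "finite T" "S \<inter> T = {}"
  shows "nonadj_pairs E (S \<union> T) (S \<union> T) \<ge> nonadj_pairs E S S + 2 * nonadj_pairs E S T"
proof -
  have "nonadj_pairs E (S \<union> T) (S \<union> T) = nonadj_pairs E (S \<union> T) S + nonadj_pairs E (S \<union> T) T"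
    by (rule nonadj_pairs_Un_right) fact+
  also have "\<dots> = nonadj_pairs E S S + nonadj_pairs E S T
      + (nonadj_pairs E T S + nonadj_pairs E T T)"
    using assms by (simp add: nonadj_pairs_commute[of _ "S \<union> T"] nonadj_pairs_Un_right)
  finally show ?thesis
    by (simp add: nonadj_pairs_commute[of _ T S])
qed

lemma nonadj_pairs_eq_sum_card:
  assumes "finite T"
  shows "nonadj_pairs E S T = (\<Sum>p\<in>S. card (T - closed_nbhd E p))"
  unfolding nonadj_pairs_def
proof (rule sum.cong[OF refl])
  fix p
  have "T - closed_nbhd E p = {q \<in> T. q \<notin> closed_nbhd E p}" by auto
  then show "(\<Sum>q\<in>T. of_bool (q \<notin> closed_nbhd E p)) = card (T - closed_nbhd E p)"
    using assms by (simp add: sum.If_cases of_bool_def Int_def)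
qed

text \<open>Double counting: forgetting the order maps these pairs onto the induced edges, with
  fibres of size two.\<close>

lemma card_adjacent_pairs:
  assumes E: "\<forall>e\<in>E. card e = 2" and S: "finite S"
  shows "card {(p, q). p \<in> S \<and> q \<in> S \<and> {p, q} \<in> E} = 2 * card (induced_edges E S)"
proof -
  let ?A = "{(p, q). p \<in> S \<and> q \<in> S \<and> {p, q} \<in> E}"
  have finA: "finite ?A"
    by (rule finite_subset[of _ "S \<times> S"]) (use S in auto)
  have finF: "finite (induced_edges E S)"
    by (rule finite_subset[of _ "Pow S"]) (use S in \<open>auto simp: induced_edges_def\<close>)
  have fibre: "card {z \<in> ?A. (case z of (p, q) \<Rightarrow> {p, q}) = e} = 2" if e: "e \<in> induced_edges E S" for e
  proof -
    have "card e = 2" using e E by (auto simp: induced_edges_def)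
    then obtain a b where ab: "e = {a, b}" "a \<noteq> b" by (auto simp: card_2_iff)
    have "{z \<in> ?A. (case z of (p, q) \<Rightarrow> {p, q}) = e} = {(a, b), (b, a)}"
      using e ab by (auto simp: induced_edges_def doubleton_eq_iff insert_commute)
    then show ?thesis using ab by simp
  qed
  have "card ?A = (\<Sum>e\<in>induced_edges E S. \<Sum>z\<in>{z \<in> ?A. (case z of (p, q) \<Rightarrow> {p, q}) = e}. 1)"
    unfolding card_eq_sum
    by (rule sum.group[symmetric]) (use finA finF in \<open>auto simp: induced_edges_def\<close>)
  also have "\<dots> = (\<Sum>e\<in>induced_edges E S. 2)"
    by (rule sum.cong[OF refl]) (use fibre in simp)
  finally show ?thesis by simp
qed

text \<open>The square of \<open>S\<close> splits into nonadjacent pairs, adjacent pairs and the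
  diagonal.\<close>

lemma nonadj_pairs_self:
  assumes E: "\<forall>e\<in>E. card e = 2" and S: "finite S"
  shows "nonadj_pairs E S S + 2 * card (induced_edges E S) + card S = card S * card S"
proof -
  let ?N = "SIGMA p:S. S - closed_nbhd E p"
  let ?A = "{(p, q). p \<in> S \<and> q \<in> S \<and> {p, q} \<in> E}"
  let ?D = "(\<lambda>p. (p, p)) ` S"
  have fin: "finite ?N" "finite ?A" "finite ?D"
    using S by (auto intro: finite_subset[of ?A "S \<times> S"])
  have loop: "{p} \<notin> E" for p using E by force
  have "S \<times> S = ?N \<union> ?A \<union> ?D"
    by (auto simp: closed_nbhd_def neighborhood_def insert_commute)
  moreover have "?N \<inter> ?A = {}" "(?N \<union> ?A) \<inter> ?D = {}"
    by (auto simp: closed_nbhd_def neighborhood_def insert_commute loop)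
  ultimately have "card (S \<times> S) = card ?N + card ?A + card ?D"
    using fin by (simp add: card_Un_disjoint)
  moreover have "card ?D = card S" by (simp add: card_image inj_on_def)
  moreover have "card ?N = nonadj_pairs E S S"
    using S by (simp add: nonadj_pairs_eq_sum_card)
  ultimately show ?thesis
    using card_adjacent_pairs[OF assms] by (simp add: card_cartesian_product)
qed

context
  fixes r c :: nat and V :: "'a set" and E :: "'a set set"
  assumes regular: "triangle_regular r c V E"
begin

lemma edge_card: "\<forall>e\<in>E. card e = 2"
  using regular by (auto simp: triangle_regular_def simple_graph_def)

lemma closed_nbhd_subset: "v \<in> V \<Longrightarrow> closed_nbhd E v \<subseteq> V"
  using regular by (auto simp: triangle_regular_def simple_graph_def closed_nbhd_def neighborhood_def)

lemma not_in_neighborhood: "v \<notin> neighborhood E v"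
  using edge_card by (force simp: neighborhood_def)

lemma finite_closed_nbhd: "v \<in> V \<Longrightarrow> finite (closed_nbhd E v)"
  using regular by (auto simp: triangle_regular_def closed_nbhd_def)

lemma card_closed_nbhd: "v \<in> V \<Longrightarrow> card (closed_nbhd E v) = r + 1"
  using regular not_in_neighborhood by (auto simp: triangle_regular_def closed_nbhd_def)

text \<open>The center \<open>v\<close> is adjacent to all other points of its closed neighborhood,
  so only pairs inside the open one count. The ordered count is thus \<open>2 k\<close>, written
  without subtraction.\<close>

lemma nonadj_pairs_closed_nbhd:
  assumes v: "v \<in> V"
  shows "nonadj_pairs E (closed_nbhd E v) (closed_nbhd E v) + 2 * c + r = r * r"
proof -
  let ?N = "neighborhood E v"
  have fin: "finite ?N" and card: "card ?N = r" and c: "card (induced_edges E ?N) = c"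
    using regular v by (auto simp: triangle_regular_def)
  have sub: "closed_nbhd E v - closed_nbhd E p = ?N - closed_nbhd E p" if "p \<in> closed_nbhd E v" for p
    using that closed_nbhd_sym[of v E p] by (auto simp: closed_nbhd_def)
  have "nonadj_pairs E (closed_nbhd E v) (closed_nbhd E v)
      = (\<Sum>p\<in>closed_nbhd E v. card (?N - closed_nbhd E p))"
    using finite_closed_nbhd[OF v] by (simp add: nonadj_pairs_eq_sum_card sub)
  also have "\<dots> = (\<Sum>p\<in>?N. card (?N - closed_nbhd E p))"
    using fin not_in_neighborhood by (simp add: closed_nbhd_def)
  also have "\<dots> = nonadj_pairs E ?N ?N"
    using fin by (simp add: nonadj_pairs_eq_sum_card)
  finally show ?thesis
    using nonadj_pairs_self[OF edge_card fin] card c by simp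
qed

lemma triangle_count_upper_bound:
  assumes v: "v \<in> V" and x: "x \<in> closed_nbhd E v" and ne: "closed_nbhd E v \<noteq> closed_nbhd E x"
  shows "r + 2 * c + r \<le> r * r"
proof -
  have xV: "x \<in> V" using v x closed_nbhd_subset by blast
  define K where "K = closed_nbhd E"
  define C where "C = K v \<inter> K x"
  define Y where "Y = K v - K x"
  define Z where "Z = K x - K v"
  have Kv: "K v = C \<union> Y" and Kx: "K x = C \<union> Z" and U: "C \<inter> Y = {}" "C \<inter> Z = {}" "Y \<inter> Z = {}"
    by (auto simp: C_def Y_def Z_def)
  have fin: "finite C" "finite Y" "finite Z"
    using finite_closed_nbhd[OF v] finite_closed_nbhd[OF xV]
    by (auto simp: C_def Y_def Z_def K_def)
  have cY: "card C + card Y = r + 1" and cZ: "card C + card Z = r + 1"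
    using card_closed_nbhd[OF v] card_closed_nbhd[OF xV] fin U
    by (simp_all add: card_Un_disjoint flip: K_def, simp_all add: Kv Kx card_Un_disjoint)
  have "x \<in> C" using x by (auto simp: C_def K_def closed_nbhd_def)
  then have C1: "card C \<ge> 1" using fin by (auto simp: Suc_le_eq card_gt_0_iff)
  have "Y \<noteq> {}"
  proof
    assume "Y = {}"
    then have "Z = {}" using cY cZ fin by simp
    then show False using \<open>Y = {}\<close> ne Kv Kx by (simp add: K_def)
  qed
  then have Y1: "card Y \<ge> 1" using fin by (auto simp: Suc_le_eq card_gt_0_iff)
  have cU: "card (C \<union> Y \<union> Z) = card C + card Y + card Z"
    using fin U by (simp add: card_Un_disjoint Int_Un_distrib2)
  have "card Y \<le> card ((C \<union> Y \<union> Z) - closed_nbhd E w)" if "w \<in> C" for w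
  proof -
    have "w \<in> V" using that v closed_nbhd_subset by (auto simp: C_def K_def)
    \<comment> \<open>The left side equals \<open>card Z\<close>, which is \<open>card Y\<close>
      because \<open>C \<union> Y\<close> and \<open>C \<union> Z\<close> have equal size.\<close>
    then have "card (C \<union> Y \<union> Z) - (r + 1) \<le> card ((C \<union> Y \<union> Z) - closed_nbhd E w)"
      using diff_card_le_card_Diff[OF finite_closed_nbhd, of w "C \<union> Y \<union> Z"]
      by (simp add: card_closed_nbhd)
    then show ?thesis using cU cY cZ by linarith
  qed
  then have "card C * card Y \<le> nonadj_pairs E C (C \<union> Y \<union> Z)"
    using fin sum_bounded_below[of C "card Y" "\<lambda>w. card ((C \<union> Y \<union> Z) - closed_nbhd E w)"]
    by (simp add: nonadj_pairs_eq_sum_card)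
  also have "\<dots> = nonadj_pairs E C C + nonadj_pairs E C Y + nonadj_pairs E C Z"
    using fin U by (simp add: nonadj_pairs_Un_right Int_Un_distrib2)
  finally have "card C * card Y \<le> nonadj_pairs E C C + nonadj_pairs E C Y + nonadj_pairs E C Z" .
  \<comment> \<open>Half the sum of this bound and its analogue for \<open>Z\<close> bounds exactly
    the three-term count just obtained, with \<open>C\<close> against itself taken once.\<close>
  moreover have "nonadj_pairs E C C + 2 * nonadj_pairs E C Y + 2 * c + r \<le> r * r"
    using nonadj_pairs_Un_self_ge[of C Y E] fin U nonadj_pairs_closed_nbhd[OF v] Kv
    by (simp add: K_def)
  moreover have "nonadj_pairs E C C + 2 * nonadj_pairs E C Z + 2 * c + r \<le> r * r"
    using nonadj_pairs_Un_self_ge[of C Z E] fin U nonadj_pairs_closed_nbhd[OF xV] Kx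
    by (simp add: K_def)
  \<comment> \<open>For positive factors with sum \<open>r + 1\<close>, the product is
    \<open>(m + 1) * (n + 1) = m * n + r\<close>.\<close>
  moreover have "r \<le> card C * card Y"
  proof -
    obtain m n where "card C = Suc m" "card Y = Suc n"
      using C1 Y1 by (metis Suc_le_D One_nat_def)
    then show ?thesis using cY by simp
  qed
  ultimately show ?thesis by linarith
qed

text \<open>Either \<open>2 k \<ge> r\<close>, or adjacent vertices always share their closed
  neighborhood; then each closed neighborhood is a clique and \<open>k = 0\<close>.\<close>

lemma triangle_count_dichotomy: "2 * c + r = r * r \<or> r + 2 * c + r \<le> r * r"
proof (rule disjCI)
  assume "\<not> r + 2 * c + r \<le> r * r"
  then have eq: "closed_nbhd E v = closed_nbhd E x" if "v \<in> V" "x \<in> closed_nbhd E v" for v x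
    using triangle_count_upper_bound[OF that] by blast
  obtain v where v: "v \<in> V"
    using regular by (auto simp: triangle_regular_def simple_graph_def)
  have "nonadj_pairs E (closed_nbhd E v) (closed_nbhd E v)
      = (\<Sum>x\<in>closed_nbhd E v. card (closed_nbhd E v - closed_nbhd E x))"
    using finite_closed_nbhd[OF v] by (rule nonadj_pairs_eq_sum_card)
  also have "\<dots> = (\<Sum>x\<in>closed_nbhd E v. 0)"
    by (rule sum.cong[OF refl]) (use eq[OF v] in auto)
  finally show "2 * c + r = r * r"
    using nonadj_pairs_closed_nbhd[OF v] by simp
qed

end

theorem theorem1p2:
  fixes r c :: nat
  assumes "r > 0"
    and "int (r choose 2) - \<lfloor>(real r - 2) / 2\<rfloor> \<le> int c"
    and "int c \<le> int (r choose 2) - 1"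
  shows "\<not> (\<exists>(V :: 'a set) (E :: 'a set set). triangle_regular r c V E)"
proof
  assume "\<exists>(V :: 'a set) (E :: 'a set set). triangle_regular r c V E"
  then have "2 * c + r = r * r \<or> r + 2 * c + r \<le> r * r"
    using triangle_count_dichotomy by blast
  moreover have "2 * (r choose 2) + r = r * r"
  proof -
    have "even (r * (r - 1))" by (cases r) auto
    then have "2 * (r choose 2) = r * (r - 1)"
      unfolding choose_two by (rule dvd_mult_div_cancel)
    then show ?thesis using \<open>r > 0\<close> by (cases r) auto
  qed
  \<comment> \<open>The assumed lower bound on \<open>c\<close> now gives
    \<open>2 k \<le> r - 2\<close>, against the second alternative; the upper bound gives
    \<open>k \<ge> 1\<close>, against the first.\<close>
  moreover have "2 * \<lfloor>(real r - 2) / 2\<rfloor> \<le> int r - 2"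
  proof -
    have "real_of_int (2 * \<lfloor>(real r - 2) / 2\<rfloor>) \<le> real_of_int (int r - 2)"
      using of_int_floor_le[of "(real r - 2) / 2"] by simp
    then show ?thesis by (simp only: of_int_le_iff)
  qed
  ultimately show False
    using assms by linarith
qed

end
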